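(* Let $G$ be a graph of order $n$ with $\alpha(G)=4$. Then the independence polynomial $I(G^{*};x)$ is unimodal, and it has a mode $k$ satisfying \[ \left\lfloor \frac{n+1}{2}\right\rfloor \leq k\leq \left\lfloor \frac{n+1}{2}\right\rfloor +2. \] Moreover, if $n$ is odd, then it has a mode $k$ satisfying $\left\lfloor \frac{n+1}{2}\right\rfloor \leq k\leq \left\lfloor \frac{n+1}{2}\right\rfloor +1$.
   Context: All graphs are simple (finite, undirected, no loops or multiple edges). A stable set is a set of pairwise non-adjacent vertices; $\alpha(G)$ is the maximum size of a stable set in $G$. If $s_k$ denotes the number of stable sets of cardinality $k$ in $G$, the independence polynomial is $I(G;x)=\sum_{k=0}^{\alpha(G)} s_k x^k$. A sequence $a_0,\dots,a_n$ is unimodal if there is an index $k$ (called a mode) with $a_0\leq a_1\leq\cdots\leq a_k\geq a_{k+1}\geq\cdots\geq a_n$; a polynomial is unimodal if its coefficient sequence is, and its mode is the mode of that sequence. For a graph $G$ with vertex set $\{v_1,\dots,v_n\}$, $G^{*}$ is the graph obtained by adding $n$ new vertices $u_1,\dots,u_n$ and the edges $u_iv_i$ ($1\le i\le n$), i.e. appending a single pendant edge to each vertex of $G$. *)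

theory Defs
  imports "Graph_Theory.Pair_Digraph" "HOL-Computational_Algebra.Polynomial"
begin

text \<open>
  A finite simple graph is a \<open>pair_graph\<close>: a finite loopless digraph without parallel arcs whose
  arc relation is symmetric, an edge \<open>uv\<close> being the two arcs \<open>(u, v)\<close> and \<open>(v, u)\<close>.
\<close>

definition stable_set :: "'a pair_pre_digraph \<Rightarrow> 'a set \<Rightarrow> bool" where
  "stable_set G S \<longleftrightarrow> S \<subseteq> pverts G \<and> (\<forall>u\<in>S. \<forall>v\<in>S. (u, v) \<notin> parcs G)"

definition stability_number :: "'a pair_pre_digraph \<Rightarrow> nat" where
  "stability_number G = Max (card ` {S. stable_set G S})"

definition num_stable_sets :: "'a pair_pre_digraph \<Rightarrow> nat \<Rightarrow> nat" where
  "num_stable_sets G k = card {S. stable_set G S \<and> card S = k}"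

definition independence_poly :: "'a pair_pre_digraph \<Rightarrow> int poly" where
  "independence_poly G =
     (\<Sum>k = 0..stability_number G. monom (int (num_stable_sets G k)) k)"

text \<open>The original vertices are tagged \<open>Inl\<close>; \<open>Inr v\<close> is the new leaf attached to \<open>v\<close>.\<close>

definition append_pendants :: "'a pair_pre_digraph \<Rightarrow> ('a + 'a) pair_pre_digraph" where
  "append_pendants G =
     \<lparr>pverts = Inl ` pverts G \<union> Inr ` pverts G,
      parcs = {(Inl u, Inl v) | u v. (u, v) \<in> parcs G}
        \<union> {(Inl v, Inr v) | v. v \<in> pverts G}
        \<union> {(Inr v, Inl v) | v. v \<in> pverts G}\<rparr>"

definition is_mode :: "(nat \<Rightarrow> 'a::linorder) \<Rightarrow> nat \<Rightarrow> nat \<Rightarrow> bool" where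
  "is_mode a n k \<longleftrightarrow>
     k \<le> n \<and> (\<forall>i<k. a i \<le> a (Suc i)) \<and> (\<forall>i. k \<le> i \<and> i < n \<longrightarrow> a (Suc i) \<le> a i)"

definition unimodal :: "(nat \<Rightarrow> 'a::linorder) \<Rightarrow> nat \<Rightarrow> bool" where
  "unimodal a n \<longleftrightarrow> (\<exists>k. is_mode a n k)"

definition is_mode_poly :: "int poly \<Rightarrow> nat \<Rightarrow> bool" where
  "is_mode_poly p k \<longleftrightarrow> is_mode (coeff p) (degree p) k"

definition unimodal_poly :: "int poly \<Rightarrow> bool" where
  "unimodal_poly p \<longleftrightarrow> unimodal (coeff p) (degree p)"

lemma pair_graph_append_pendants:
  assumes "pair_graph G"
  shows "pair_graph (append_pendants G)"
proof -
  interpret pair_graph G by (rule assms)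
  have sym: "(v, u) \<in> parcs G" if "(u, v) \<in> parcs G" for u v
    using that pair_sym_arcs by (auto simp: symmetric_def sym_def)
  have "parcs (append_pendants G) \<subseteq> pverts (append_pendants G) \<times> pverts (append_pendants G)"
    by (auto simp: append_pendants_def dest: in_arcsD1 in_arcsD2)
  moreover have fin: "finite (pverts (append_pendants G))"
    by (simp add: append_pendants_def)
  ultimately have fin': "finite (parcs (append_pendants G))"
    by (meson finite_SigmaI finite_subset)
  show ?thesis
    using fin fin' sym
    by unfold_locales
      (auto simp: append_pendants_def symmetric_def sym_def
        dest: in_arcsD1 in_arcsD2 no_loops)
qed

end

theory Submission
  imports Defs
begin

text \<open>
  A stable set of \<open>G*\<close> consists of a stable set \<open>S\<close> of \<open>G\<close> and any set of leaves avoiding those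
  at \<open>S\<close>, so the number of stable sets of size \<open>i\<close> is the sum of \<open>C(n - |S|, i - |S|)\<close> over
  all stable \<open>S\<close>. Each summand increases in \<open>i\<close> up to \<open>(n + |S|)/2\<close> and decreases afterwards.
  As \<open>0 \<le> |S| \<le> 4\<close>, this settles every step outside the window from \<open>h = (n + 1) div 2\<close> to
  \<open>h + 2\<close>, and for odd \<open>n\<close> also the last step in it. For \<open>n = 2 m\<close> the only summand that drops
  from \<open>m\<close> to \<open>m + 1\<close> is that of the empty set, by the Catalan number \<open>Cat m\<close>, while each stable
  pair gains \<open>Cat (m - 1) \<ge> Cat m / 4\<close>; a stable set of size 4 contains six such pairs.
\<close>

section \<open>Binomial inequalities\<close>

text \<open>The ratio of neighbours in a row of Pascal's triangle, free of division: comparing them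
  reduces to comparing \<open>N - j\<close> with \<open>Suc j\<close>.\<close>

lemma binomial_step: "Suc j * (N choose Suc j) = (N - j) * (N choose j)"
  by (simp only: binomial_absorption binomial_absorb_comp)

lemma binomial_Suc_mono:
  assumes "2 * j + 1 \<le> N"
  shows "N choose j \<le> N choose Suc j"
proof -
  have "Suc j * (N choose j) \<le> (N - j) * (N choose j)"
    using assms by (intro mult_right_mono) auto
  also have "\<dots> = Suc j * (N choose Suc j)"
    by (simp only: binomial_step)
  finally show ?thesis
    by (simp only: Suc_mult_le_cancel1)
qed

lemma binomial_Suc_antimono:
  assumes "N \<le> 2 * j + 1"
  shows "N choose Suc j \<le> N choose j"
proof -
  have "Suc j * (N choose Suc j) = (N - j) * (N choose j)"
    by (rule binomial_step)
  also have "\<dots> \<le> Suc j * (N choose j)"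
    using assms by (intro mult_right_mono) auto
  finally show ?thesis
    by (simp only: Suc_mult_le_cancel1)
qed

text \<open>\<open>Cat m \<le> 4 * Cat (m - 1)\<close> for \<open>m = q + 2\<close>, with each Catalan number written as a difference
  of adjacent binomial coefficients and the subtractions moved across.\<close>

lemma central_binomial_drop_le:
  "(2 * q + 4 choose (q + 2)) + 4 * (2 * q + 2 choose q)
    \<le> (2 * q + 4 choose (q + 3)) + 4 * (2 * q + 2 choose (q + 1))"
proof -
  \<comment> \<open>Pascal's rule, applied twice, expands everything in \<open>A\<close>,
    \<open>B\<close>, \<open>D\<close>; the claim becomes
    \<open>4 * B \<le> 3 * A + D\<close>.\<close>
  define A B D where "A = 2 * q + 2 choose (q + 1)" and "B = 2 * q + 2 choose (q + 2)"
    and "D = 2 * q + 2 choose (q + 3)"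
  have B: "2 * q + 2 choose q = B"
    using binomial_symmetric[of q "2 * q + 2"] by (simp add: B_def)
  have AB: "(q + 2) * B = (q + 1) * A"
    using binomial_step[of "q + 1" "2 * q + 2"] by (simp add: A_def B_def)
  have BD: "(q + 3) * D = q * B"
    using binomial_step[of "q + 2" "2 * q + 2"] by (simp add: B_def D_def eval_nat_numeral)
  have "A \<ge> B"
    using binomial_Suc_antimono[of "2 * q + 2" "q + 1"] by (simp add: A_def B_def)
  \<comment> \<open>Differences are taken in the integers: \<open>B - D = 3 B / (q + 3)\<close> and
    \<open>A - B = B / (q + 1)\<close>, whence the factor 3.\<close>
  have "int (q + 3) * (int B - int D) = 3 * int B"
    using BD by (simp add: algebra_simps flip: of_nat_mult of_nat_add)
  also have "\<dots> = int (q + 1) * (3 * (int A - int B))"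
    using arg_cong[OF AB, of int] by (simp add: algebra_simps)
  also have "\<dots> \<le> int (q + 3) * (3 * (int A - int B))"
    using \<open>A \<ge> B\<close> by (intro mult_right_mono) auto
  finally have "int B - int D \<le> 3 * (int A - int B)"
    by (rule mult_left_le_imp_le) simp
  then have "int (4 * B) \<le> int (3 * A + D)"
    by simp
  then have "4 * B \<le> 3 * A + D"
    by (simp only: of_nat_le_iff)
  moreover have "2 * q + 4 choose (q + 2) = (2 * q + 2 choose q) + 2 * A + B"
    by (simp add: A_def B_def eval_nat_numeral)
  moreover have "2 * q + 4 choose (q + 3) = A + 2 * B + D"
    by (simp add: A_def B_def D_def eval_nat_numeral)
  ultimately show ?thesis
    unfolding B A_def[symmetric] by linarith
qed

text \<open>The coefficient of \<open>x ^ i\<close> in \<open>x ^ k * (1 + x) ^ (n - k)\<close>.\<close>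

definition shifted_binomial :: "nat \<Rightarrow> nat \<Rightarrow> nat \<Rightarrow> nat" where
  "shifted_binomial n k i = (if k \<le> i then (n - k) choose (i - k) else 0)"

lemma shifted_binomial_mono:
  assumes "k \<le> n" "2 * i + 1 \<le> n + k"
  shows "shifted_binomial n k i \<le> shifted_binomial n k (Suc i)"
  using assms binomial_Suc_mono[of "i - k" "n - k"]
  by (auto simp: shifted_binomial_def Suc_diff_le)

lemma shifted_binomial_antimono:
  assumes "k \<le> n" "n + k \<le> 2 * i + 1"
  shows "shifted_binomial n k (Suc i) \<le> shifted_binomial n k i"
proof -
  \<comment> \<open>Since \<open>2 * k \<le> n + k \<le> 2 * i + 1\<close>, the jump from the
    default 0 to 1 at \<open>i = k - 1\<close> is excluded.\<close>
  have "k \<le> i"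
    using assms by linarith
  then show ?thesis
    using assms binomial_Suc_antimono[of "n - k" "i - k"]
    by (auto simp: shifted_binomial_def Suc_diff_le)
qed

section \<open>Stable sets\<close>

lemma (in pair_graph) finite_pverts: "finite (pverts G)"
  by (rule pair_finite_verts)

lemma stable_set_empty: "stable_set G {}"
  by (simp add: stable_set_def)

lemma stable_set_subset: "stable_set G S \<Longrightarrow> T \<subseteq> S \<Longrightarrow> stable_set G T"
  by (auto simp: stable_set_def)

lemma finite_stable_sets: "finite (pverts G) \<Longrightarrow> finite {S. stable_set G S}"
  by (rule finite_subset[of _ "Pow (pverts G)"]) (auto simp: stable_set_def)

lemma card_le_stability_number:
  "finite (pverts G) \<Longrightarrow> stable_set G S \<Longrightarrow> card S \<le> stability_number G"
  by (auto simp: stability_number_def finite_stable_sets intro!: Max_ge)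

lemma stability_number_attained:
  assumes "finite (pverts G)"
  obtains S where "stable_set G S" "card S = stability_number G"
proof -
  have "stability_number G \<in> card ` {S. stable_set G S}"
    unfolding stability_number_def
    using assms stable_set_empty by (intro Max_in) (auto simp: finite_stable_sets)
  then show ?thesis
    using that by auto
qed

lemma coeff_independence_poly:
  assumes "finite (pverts G)"
  shows "coeff (independence_poly G) i = int (num_stable_sets G i)"
proof (cases "i \<le> stability_number G")
  case True
  then show ?thesis
    by (simp add: independence_poly_def coeff_sum)
next
  case False
  then have "{S. stable_set G S \<and> card S = i} = {}"
    using card_le_stability_number[OF assms] by auto
  then have "num_stable_sets G i = 0"
    by (simp only: num_stable_sets_def card.empty)
  then show ?thesis
    using False by (simp add: independence_poly_def coeff_sum)
qed

text \<open>A leaf is adjacent only to the vertex it hangs from, so leaves constrain each other in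
  no way.\<close>

lemma stable_set_append_pendants:
  "stable_set (append_pendants G) (S <+> T) \<longleftrightarrow> stable_set G S \<and> T \<subseteq> pverts G - S"
proof -
  have ball: "(\<forall>x\<in>S <+> T. P x) \<longleftrightarrow> (\<forall>x\<in>S. P (Inl x)) \<and> (\<forall>x\<in>T. P (Inr x))" for P
    by auto
  have "S <+> T \<subseteq> pverts (append_pendants G) \<longleftrightarrow> S \<subseteq> pverts G \<and> T \<subseteq> pverts G"
    unfolding subset_iff by (auto simp: append_pendants_def)
  moreover have "(Inl u, Inl v) \<in> parcs (append_pendants G) \<longleftrightarrow> (u, v) \<in> parcs G"
    "(Inl u, Inr v) \<in> parcs (append_pendants G) \<longleftrightarrow> u = v \<and> v \<in> pverts G"
    "(Inr u, Inl v) \<in> parcs (append_pendants G) \<longleftrightarrow> u = v \<and> v \<in> pverts G"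
    "(Inr u, Inr v) \<notin> parcs (append_pendants G)" for u v
    by (auto simp: append_pendants_def)
  ultimately show ?thesis
    unfolding stable_set_def ball by simp blast
qed

lemma num_stable_sets_append_pendants:
  assumes fin: "finite (pverts G)"
  shows "num_stable_sets (append_pendants G) i
    = (\<Sum>S | stable_set G S. shifted_binomial (card (pverts G)) (card S) i)"
proof -
  let ?V = "pverts G"
  define leaves where "leaves S = {T. T \<subseteq> ?V - S \<and> card S + card T = i}" for S
  have finS: "finite S" "card S \<le> card ?V" "card (?V - S) = card ?V - card S"
    if "stable_set G S" for S
    using that fin by (auto simp: stable_set_def intro: finite_subset card_mono card_Diff_subset)
  \<comment> \<open>Splitting \<open>W\<close> into original vertices and leaves is a bijection onto
    a dependent product, which is then counted fibre by fibre over \<open>S\<close>.\<close>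
  have "{W. stable_set (append_pendants G) W \<and> card W = i}
      = (\<lambda>(S, T). S <+> T) ` Sigma {S. stable_set G S} leaves" (is "?L = ?R")
  proof (intro equalityI subsetI)
    fix W assume W: "W \<in> ?L"
    define S T where "S = Inl -` W" and "T = Inr -` W"
    have WST: "W = S <+> T"
    proof (rule set_eqI)
      show "x \<in> W \<longleftrightarrow> x \<in> S <+> T" for x
        by (cases x) (auto simp: S_def T_def)
    qed
    then have *: "stable_set G S" "T \<subseteq> ?V - S"
      using W by (simp_all add: stable_set_append_pendants)
    then have "finite T"
      using fin by (meson finite_Diff finite_subset)
    with * W WST finS have "T \<in> leaves S"
      by (auto simp: leaves_def card_Plus)
    with * WST show "W \<in> ?R"
      by auto
  next
    fix W assume "W \<in> ?R"
    then obtain S T where *: "W = S <+> T" "stable_set G S" "T \<in> leaves S"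
      by auto
    then have "finite T"
      using fin by (auto simp: leaves_def intro: finite_subset)
    with * finS show "W \<in> ?L"
      by (auto simp: leaves_def card_Plus stable_set_append_pendants)
  qed
  moreover have "inj_on (\<lambda>(S, T). S <+> T) (Sigma {S. stable_set G S} leaves)"
    by (auto simp: inj_on_def Plus_def)
  ultimately have "num_stable_sets (append_pendants G) i = card (Sigma {S. stable_set G S} leaves)"
    by (simp add: num_stable_sets_def card_image)
  also have "\<dots> = (\<Sum>S | stable_set G S. card (leaves S))"
    using fin by (intro card_SigmaI) (auto simp: finite_stable_sets leaves_def)
  also have "\<dots> = (\<Sum>S | stable_set G S. shifted_binomial (card ?V) (card S) i)"
  proof (rule sum.cong)
    fix S assume "S \<in> {S. stable_set G S}"
    then have S: "stable_set G S"
      by simp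
    show "card (leaves S) = shifted_binomial (card ?V) (card S) i"
    proof (cases "card S \<le> i")
      case True
      then have "leaves S = {T. T \<subseteq> ?V - S \<and> card T = i - card S}"
        by (auto simp: leaves_def)
      then show ?thesis
        using n_subsets[of "?V - S" "i - card S"] True fin finS(3)[OF S]
        by (simp add: shifted_binomial_def)
    qed (simp add: leaves_def shifted_binomial_def)
  qed simp
  finally show ?thesis .
qed

section \<open>Shape of the coefficient sequence\<close>

text \<open>Modes refer to the degree, so the end of the coefficient sequence has to be
  located.\<close>

lemma degree_independence_poly_append_pendants:
  assumes "pair_graph G"
  shows "degree (independence_poly (append_pendants G)) = card (pverts G)"
proof -
  let ?n = "card (pverts G)" and ?P = "independence_poly (append_pendants G)"
  have fin: "finite (pverts G)" "finite (pverts (append_pendants G))"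
    using assms pair_graph_append_pendants[OF assms]
    by (simp_all add: pair_graph.finite_pverts)
  have coeff: "coeff ?P i = int (\<Sum>S | stable_set G S. shifted_binomial ?n (card S) i)" for i
    by (simp only: coeff_independence_poly[OF fin(2)] num_stable_sets_append_pendants[OF fin(1)])
  have card_le: "card S \<le> ?n" if "stable_set G S" for S
    using that fin by (auto simp: stable_set_def intro: card_mono)
  show ?thesis
  proof (rule antisym)
    show "degree ?P \<le> ?n"
    proof (rule degree_le, intro allI impI)
      fix i assume "?n < i"
      then have "shifted_binomial ?n (card S) i = 0" if "stable_set G S" for S
        using card_le[OF that] by (auto simp: shifted_binomial_def binomial_eq_0)
      then show "coeff ?P i = 0"
        by (simp add: coeff)
    qed
    \<comment> \<open>The empty set contributes 1 to the coefficient at \<open>?n\<close>: the set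
      of all leaves is stable.\<close>
    have "shifted_binomial ?n (card ({} :: 'a set)) ?n
        \<le> (\<Sum>S | stable_set G S. shifted_binomial ?n (card S) ?n)"
      using fin by (intro member_le_sum) (auto simp: finite_stable_sets stable_set_empty)
    then have "coeff ?P ?n \<noteq> 0"
      by (simp add: coeff shifted_binomial_def del: of_nat_sum)
    then show "?n \<le> degree ?P"
      by (rule le_degree)
  qed
qed

theorem theorem4:
  fixes G :: "'a pair_pre_digraph" and n :: nat
  assumes "pair_graph G"
    and "card (pverts G) = n"
    and "stability_number G = 4"
  shows "unimodal_poly (independence_poly (append_pendants G))
    \<and> (\<exists>k. is_mode_poly (independence_poly (append_pendants G)) k
          \<and> (n + 1) div 2 \<le> k \<and> k \<le> (n + 1) div 2 + 2)
    \<and> (odd n \<longrightarrow>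
        (\<exists>k. is_mode_poly (independence_poly (append_pendants G)) k
          \<and> (n + 1) div 2 \<le> k \<and> k \<le> (n + 1) div 2 + 1))"
proof -
  let ?P = "independence_poly (append_pendants G)"
  let ?St = "{S. stable_set G S}"
  define h where "h = (n + 1) div 2"
  define a where "a i = (\<Sum>S\<in>?St. shifted_binomial n (card S) i)" for i
  have fin: "finite (pverts G)" "finite (pverts (append_pendants G))"
    using assms(1) pair_graph_append_pendants[OF assms(1)]
    by (simp_all add: pair_graph.finite_pverts)
  have coeff: "coeff ?P i = int (a i)" for i
    using assms(2)
    by (simp only: coeff_independence_poly[OF fin(2)] num_stable_sets_append_pendants[OF fin(1)]
        a_def)
  have mode_iff: "is_mode_poly ?P k \<longleftrightarrow>
      k \<le> n \<and> (\<forall>i<k. a i \<le> a (Suc i)) \<and> (\<forall>i. k \<le> i \<and> i < n \<longrightarrow> a (Suc i) \<le> a i)" for k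
    using assms(2)
    by (simp add: is_mode_poly_def is_mode_def coeff
        degree_independence_poly_append_pendants[OF assms(1)])
  have card_le: "card S \<le> n" "card S \<le> 4" if "stable_set G S" for S
    using that assms(2,3) fin card_le_stability_number[OF fin(1) that]
    by (auto simp: stable_set_def intro: card_mono)
  obtain S0 where S0: "stable_set G S0" "card S0 = 4"
    using stability_number_attained[OF fin(1)] assms(3) by metis
  have "n \<ge> 4"
    using card_le(1)[OF S0(1)] S0(2) by simp

  \<comment> \<open>\<open>i < h\<close> means \<open>2 * i + 1 \<le> n\<close>, the rising
    condition for size 0 and hence for every size.\<close>
  have rise: "a i \<le> a (Suc i)" if "i < h" for i
    unfolding a_def
  proof (rule sum_mono)
    fix S assume "S \<in> ?St"
    then show "shifted_binomial n (card S) i \<le> shifted_binomial n (card S) (Suc i)"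
      using card_le(1) that by (intro shifted_binomial_mono) (auto simp: h_def)
  qed
  \<comment> \<open>The hypothesis is the falling condition for the largest size, 4.\<close>
  have fall: "a (Suc i) \<le> a i" if "n + 4 \<le> 2 * i + 1" for i
    unfolding a_def
  proof (rule sum_mono)
    fix S assume S: "S \<in> ?St"
    then show "shifted_binomial n (card S) (Suc i) \<le> shifted_binomial n (card S) i"
      using card_le[of S] that by (intro shifted_binomial_antimono) auto
  qed

  have mode_odd: "\<exists>k. is_mode_poly ?P k \<and> h \<le> k \<and> k \<le> h + 1" if odd: "odd n"
  proof -
    obtain m where m: "n = 2 * m + 1"
      using odd by (rule oddE)
    have h: "h = m + 1"
      by (simp add: h_def m)
    have fall': "a (Suc i) \<le> a i" if "h + 1 \<le> i" for i
      using that by (intro fall) (simp add: h m)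
    show ?thesis
    \<comment> \<open>Only the step from \<open>h\<close> to \<open>h + 1\<close> is undecided; its
      direction selects the mode.\<close>
    proof (cases "a h \<le> a (Suc h)")
      case True
      then have "is_mode_poly ?P (h + 1)"
        using rise fall' \<open>n \<ge> 4\<close> m h by (auto simp: mode_iff less_Suc_eq)
      then show ?thesis
        by auto
    next
      case False
      have "is_mode_poly ?P h"
        unfolding mode_iff
      proof (intro conjI allI impI)
        show "a (Suc i) \<le> a i" if "h \<le> i \<and> i < n" for i
          using False fall'[of i] that by (cases "i = h") auto
      qed (use rise h m in auto)
      then show ?thesis
        by auto
    qed
  qed

  have mode_even: "\<exists>k. is_mode_poly ?P k \<and> h \<le> k \<and> k \<le> h + 2" if even: "even n"
  proof -
    obtain q where q: "n = 2 * q + 4"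
    proof
      show "n = 2 * (n div 2 - 2) + 4"
        using even \<open>n \<ge> 4\<close> by auto
    qed
    have h: "h = q + 2"
      by (simp add: h_def q)
    define pairs where "pairs = {S. S \<subseteq> S0 \<and> card S = 2}"
    \<comment> \<open>The one summand that drops at \<open>h\<close>, grouped with the six pairs
      inside \<open>S0\<close> that make up for it.\<close>
    define Q where "Q = insert {} pairs"
    have "finite S0"
      using S0(2) by (metis card.infinite zero_neq_numeral)
    then have "finite pairs" and card_pairs: "card pairs = 6"
      using n_subsets[of S0 2] S0(2) by (auto simp: pairs_def choose_two)
    have "Q \<subseteq> ?St"
      using S0(1) by (auto simp: Q_def pairs_def stable_set_empty intro: stable_set_subset)
    have "{} \<notin> pairs"
      by (simp add: pairs_def)
    have sum_Q: "(\<Sum>S\<in>Q. shifted_binomial n (card S) i)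
        = shifted_binomial n 0 i + 6 * shifted_binomial n 2 i" for i
    proof -
      have "(\<Sum>S\<in>pairs. shifted_binomial n (card S) i) = (\<Sum>S\<in>pairs. shifted_binomial n 2 i)"
        by (rule sum.cong) (auto simp: pairs_def)
      then show ?thesis
        using \<open>finite pairs\<close> \<open>{} \<notin> pairs\<close> by (simp add: Q_def card_pairs)
    qed
    have "shifted_binomial n 0 h + 4 * shifted_binomial n 2 h
        \<le> shifted_binomial n 0 (Suc h) + 4 * shifted_binomial n 2 (Suc h)"
      using central_binomial_drop_le[of q]
      by (simp add: shifted_binomial_def h q eval_nat_numeral del: binomial_Suc_Suc)
    \<comment> \<open>Four pairs already offset the drop; the other two must merely not
      decrease.\<close>
    moreover have "shifted_binomial n 2 h \<le> shifted_binomial n 2 (Suc h)"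
      by (rule shifted_binomial_mono) (auto simp: h q)
    ultimately have "(\<Sum>S\<in>Q. shifted_binomial n (card S) h)
        \<le> (\<Sum>S\<in>Q. shifted_binomial n (card S) (Suc h))"
      unfolding sum_Q by linarith
    \<comment> \<open>Sets outside \<open>Q\<close> are nonempty, and
      \<open>2 * h + 1 = n + 1\<close> is the rising condition for size 1.\<close>
    moreover have "(\<Sum>S\<in>?St - Q. shifted_binomial n (card S) h)
        \<le> (\<Sum>S\<in>?St - Q. shifted_binomial n (card S) (Suc h))"
    proof (rule sum_mono)
      fix S assume S: "S \<in> ?St - Q"
      then have "finite S"
        using fin(1) by (auto simp: stable_set_def intro: finite_subset)
      with S have "card S \<noteq> 0"
        by (auto simp: Q_def)
      then show "shifted_binomial n (card S) h \<le> shifted_binomial n (card S) (Suc h)"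
        using S card_le(1) by (intro shifted_binomial_mono) (auto simp: h q)
    qed
    ultimately have rise_h: "a h \<le> a (Suc h)"
      unfolding a_def sum.subset_diff[OF \<open>Q \<subseteq> ?St\<close> finite_stable_sets[OF fin(1)]]
      by linarith
    have fall': "a (Suc i) \<le> a i" if "h + 2 \<le> i" for i
      using that by (intro fall) (simp add: h q)
    show ?thesis
    \<comment> \<open>With \<open>rise_h\<close> and \<open>fall'\<close>, only the step from
      \<open>h + 1\<close> to \<open>h + 2\<close> remains open.\<close>
    proof (cases "a (h + 1) \<le> a (Suc (h + 1))")
      case True
      then have "is_mode_poly ?P (h + 2)"
        using rise rise_h fall' q h by (auto simp: mode_iff less_Suc_eq)
      then show ?thesis
        by auto
    next
      case False
      have "is_mode_poly ?P (h + 1)"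
        unfolding mode_iff
      proof (intro conjI allI impI)
        show "a (Suc i) \<le> a i" if "h + 1 \<le> i \<and> i < n" for i
          using False fall'[of i] that by (cases "i = h + 1") auto
      qed (use rise rise_h h q in \<open>auto simp: less_Suc_eq\<close>)
      then show ?thesis
        by auto
    qed
  qed

  have "\<exists>k. is_mode_poly ?P k \<and> h \<le> k \<and> k \<le> h + 2"
  proof (cases "odd n")
    case True
    then show ?thesis
      using mode_odd by (meson le_trans add_left_mono one_le_numeral)
  qed (use mode_even in auto)
  then show ?thesis
    using mode_odd unfolding h_def unimodal_poly_def unimodal_def is_mode_poly_def by auto
qed

end
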